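(* Let $d$ be a positive integer and let $\mu_1, \ldots, \mu_{d+1}$ be $d+1$ finite measures on $\mathbb{R}^d$, each absolutely continuous with respect to the Lebesgue measure, whose supports $K_1, \ldots, K_{d+1}$ are well separated. Let $\alpha_1, \ldots, \alpha_{d+1}$ be real numbers in $(0,1)$. Then there exist two parallel hyperplanes $H_1, H_2$ in $\mathbb{R}^d$ such that the region $A$ between them satisfies \[ \mu_i(A) = \alpha_i \cdot \mu_i(\mathbb{R}^d) \quad \text{for all } i = 1, \ldots, d+1. \]
   Context: A family of sets $K_1, \ldots, K_m$ in $\mathbb{R}^d$ is called well separated if for every partition of the index set $\{1,\ldots,m\}$ into two parts $I, J$, there is a hyperplane separating $\bigcup_{i\in I} K_i$ from $\bigcup_{j \in J} K_j$ (i.e. the two unions lie in opposite closed half-spaces). *)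

theory Defs
  imports "HOL-Analysis.Analysis"
begin

(* Topological support: the complement of the union of all open null sets. *)
definition measure_support :: "'a::topological_space measure \<Rightarrow> 'a set" where
  "measure_support M = {x. \<forall>U. open U \<longrightarrow> x \<in> U \<longrightarrow> emeasure M U > 0}"

(* The two parts of a partition are nonempty; hyperplanes are {x. u \<bullet> x = c} with u \<noteq> 0,
   and separation is weak (opposite closed half-spaces). *)
definition well_separated :: "'i set \<Rightarrow> ('i \<Rightarrow> 'a::real_inner set) \<Rightarrow> bool" where
  "well_separated S K \<longleftrightarrow>
     (\<forall>I J. I \<union> J = S \<longrightarrow> I \<inter> J = {} \<longrightarrow> I \<noteq> {} \<longrightarrow> J \<noteq> {} \<longrightarrow>
        (\<exists>u c. u \<noteq> 0 \<and> (\<Union>i\<in>I. K i) \<subseteq> {x. u \<bullet> x \<le> c} \<and> (\<Union>j\<in>J. K j) \<subseteq> {x. u \<bullet> x \<ge> c}))"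

end

(* Idea.  Index the measures of positive mass by 0, ..., d.  From the hyperplanes that separate them
   one builds, depending continuously and oddly on positions y_0 = 0, y_1, ..., y_d, an affine
   functional that is nonpositive on the support of the measure in lowest position and nonnegative on
   the support of the measure in highest position.  A point (s, y_1, ..., y_d) of the sphere S^d is
   sent to the masses of the slab on which this functional has absolute value at most s, minus the
   prescribed masses.  This map is invariant under the reflection (s, y) -> (s, -y).  Moving the lower
   boundary hyperplane to minus infinity deforms it to the corresponding map for half-spaces, and
   separation forces the latter to be homotopic, away from 0, to a linear isomorphism.  If no slab
   were a solution, we would get a self-map of S^d that is invariant under the reflection and
   homotopic to the identity.  This is impossible: the fundamental cycle has the form
   c + e r(c), where r is induced by the reflection and e = 1 or e = -1, so an invariant map sends it
   to twice a chain, but the fundamental class is not divisible by 2. *)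

theory Submission
  imports Defs "HOL-Homology.Homology"
begin

section \<open>Reflection-invariant self-maps of spheres\<close>

text \<open>Coordinate 0 is kept because it will carry the half-width of a slab; the other
  coordinates are positions, and negating them will reverse the normal of the slab.\<close>

definition axis_flip :: "(nat \<Rightarrow> real) \<Rightarrow> nat \<Rightarrow> real" where
  "axis_flip x = (\<lambda>i. if i = 0 then x i else - x i)"

text \<open>Vanishing of the class of \<open>c\<close> in homology modulo 2.\<close>

definition even_class :: "nat \<Rightarrow> 'a topology \<Rightarrow> 'a set \<Rightarrow> 'a chain \<Rightarrow> bool" where
  "even_class p X S c \<longleftrightarrow>
     (\<exists>y. singular_chain p X y \<and> singular_relboundary p X S (c - frag_cmul 2 y))"

lemma axis_flip_0 [simp]: "axis_flip x 0 = x 0"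
  by (simp add: axis_flip_def)

lemma axis_flip_pos [simp]: "i > 0 \<Longrightarrow> axis_flip x i = - x i"
  by (simp add: axis_flip_def)

lemma axis_flip_axis_flip [simp]: "axis_flip (axis_flip x) = x"
  by (auto simp: axis_flip_def)

lemma axis_flip_sum_squares: "(\<Sum>i\<le>n. (axis_flip x i)\<^sup>2) = (\<Sum>i\<le>n. (x i)\<^sup>2)"
  by (intro sum.cong) (auto simp: axis_flip_def)

lemma axis_flip_in_nsphere: "x \<in> topspace (nsphere n) \<Longrightarrow> axis_flip x \<in> topspace (nsphere n)"
  by (simp add: nsphere axis_flip_sum_squares)

lemma continuous_map_axis_flip: "continuous_map (nsphere n) (nsphere n) axis_flip"
proof -
  have 1: "continuous_map (nsphere n) euclideanreal (\<lambda>x. axis_flip x k)" for k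
    by (cases "k = 0") (auto intro!: continuous_intros continuous_map_nsphere_projection)
  have "continuous_map (nsphere n) (powertop_real UNIV) axis_flip"
    by (simp add: continuous_map_componentwise_UNIV 1)
  moreover have "axis_flip ` topspace (nsphere n) \<subseteq> {x. (\<Sum>i\<le>n. x i ^ 2) = 1 \<and> (\<forall>i>n. x i = 0)}"
    using axis_flip_in_nsphere by (fastforce simp: nsphere)
  ultimately show ?thesis
    by (subst (2) nsphere) (auto simp: continuous_map_in_subtopology)
qed

section \<open>Divisibility by 2 in relative homology\<close>

lemma keys_frag_cmul_2: "Poly_Mapping.keys (frag_cmul 2 c) = Poly_Mapping.keys c"
  by (auto simp: in_keys_iff)

text \<open>The boundary of \<open>2 y\<close> lies in \<open>T\<close>. Chain groups are free over
  the integers, so doubling does not change which simplices occur, and the boundary of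
  \<open>y\<close> lies in \<open>T\<close> as well.\<close>

lemma singular_relcycle_diff_even:
  assumes "singular_relcycle p X S c" "singular_chain p X y"
    "singular_relboundary p X T (c - frag_cmul 2 y)" "S \<subseteq> T"
  shows "singular_relcycle p X T y"
proof -
  have "singular_relcycle p X T (c - frag_cmul 2 y)"
    using assms(3) by (rule singular_relboundary_imp_relcycle)
  moreover have "singular_relcycle p X T c"
    using assms(1,4) by (auto simp: singular_relcycle intro: singular_chain_mono)
  ultimately have "singular_relcycle p X T (c - (c - frag_cmul 2 y))"
    by (rule singular_relcycle_diff[rotated])
  then have "singular_chain (p - 1) (subtopology X T) (frag_cmul 2 (chain_boundary p y))"
    by (simp add: singular_relcycle chain_boundary_cmul)
  then have "singular_chain (p - 1) (subtopology X T) (chain_boundary p y)"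
    by (simp add: singular_chain_def keys_frag_cmul_2)
  then show ?thesis
    using assms(2) by (simp add: singular_relcycle)
qed

text \<open>Inclusion induces an isomorphism from the homology of the upper hemisphere relative to
  the equator onto that of the sphere relative to the lower hemisphere. Divisibility by 2 is pulled
  back along it.\<close>

lemma even_class_upper_hemisphere:
  assumes c: "singular_relcycle p (subtopology (nsphere n) {x. 0 \<le> x k}) {x. x k = 0} c"
    and ev: "even_class p (nsphere n) {x. x k \<le> 0} c"
  shows "even_class p (subtopology (nsphere n) {x. 0 \<le> x k}) {x. x k = 0} c"
proof -
  let ?S = "nsphere n" and ?L = "{x::nat\<Rightarrow>real. x k \<le> 0}" and ?U = "subtopology (nsphere n) {x. 0 \<le> x k}"
    and ?E = "{x::nat\<Rightarrow>real. x k = 0}"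
  let ?h = "hom_induced p ?U ?E ?S ?L id"
  have iso: "?h \<in> iso (relative_homology_group p ?U ?E) (relative_homology_group p ?S ?L)"
    by (rule iso_relative_homology_group_upper_hemisphere)
  have h: "?h (homologous_rel_set p ?U ?E a) = homologous_rel_set p ?S ?L a"
    if "singular_relcycle p ?U ?E a" for a
  proof -
    have "?h (homologous_rel_set p ?U ?E a) = homologous_rel_set p ?S ?L (chain_map p id a)"
      using that by (intro hom_induced_chain_map) (auto simp: continuous_map_from_subtopology)
    moreover have "chain_map p id a = a"
      using that by (intro chain_map_ident) (auto simp: singular_relcycle)
    ultimately show ?thesis by simp
  qed
  obtain y where y: "singular_chain p ?S y" "singular_relboundary p ?S ?L (c - frag_cmul 2 y)"
    using ev by (auto simp: even_class_def)
  have "singular_relcycle p ?S ?L (chain_map p id c)"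
    using c by (rule singular_relcycle_chain_map) (auto simp: continuous_map_from_subtopology)
  moreover have "chain_map p id c = c"
    using c by (intro chain_map_ident) (auto simp: singular_relcycle)
  ultimately have "singular_relcycle p ?S ?L c" by simp
  then have ycyc: "singular_relcycle p ?S ?L y"
    using y singular_relcycle_diff_even by blast
  have "homologous_rel_set p ?S ?L y \<in> carrier (relative_homology_group p ?S ?L)"
    using ycyc by (auto simp: carrier_relative_homology_group)
  \<comment> \<open>Surjectivity replaces the half \<open>y\<close> by a homologous
    \<open>y'\<close> inside the upper hemisphere; injectivity, used further below, carries the
    relation \<open>c ~ 2 y'\<close> back.\<close>
  then have "homologous_rel_set p ?S ?L y \<in> ?h ` carrier (relative_homology_group p ?U ?E)"
    using iso by (auto simp: iso_def bij_betw_def)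
  then obtain y' where y': "singular_relcycle p ?U ?E y'"
      "homologous_rel_set p ?S ?L y = homologous_rel_set p ?S ?L y'"
    using h by (auto simp: carrier_relative_homology_group)
  have "singular_relboundary p ?S ?L (frag_cmul 2 (y - y'))"
    using y'(2) unfolding homologous_rel_set_eq
    by (intro singular_relboundary_cmul) (simp add: homologous_rel_def)
  then have "singular_relboundary p ?S ?L (c - frag_cmul 2 y + frag_cmul 2 (y - y'))"
    using y(2) by (intro singular_relboundary_add)
  moreover have "c - frag_cmul 2 y + frag_cmul 2 (y - y') = c - frag_cmul 2 y'"
    by (intro poly_mapping_eqI) (simp add: lookup_add lookup_minus algebra_simps)
  ultimately have b: "singular_relboundary p ?S ?L (c - frag_cmul 2 y')"
    by simp
  have cyc: "singular_relcycle p ?U ?E (c - frag_cmul 2 y')"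
    using c y'(1) by (intro singular_relcycle_diff singular_relcycle_cmul)
  have "?h (homologous_rel_set p ?U ?E (c - frag_cmul 2 y')) = ?h (homologous_rel_set p ?U ?E 0)"
    unfolding h[OF cyc] h[OF singular_relcycle_0] homologous_rel_set_eq
    using b by (simp add: homologous_rel_def)
  then have "homologous_rel_set p ?U ?E (c - frag_cmul 2 y') = homologous_rel_set p ?U ?E 0"
  proof (rule inj_onD[rotated])
    show "inj_on ?h (carrier (relative_homology_group p ?U ?E))"
      using iso by (simp add: iso_def bij_betw_def)
    show "homologous_rel_set p ?U ?E (c - frag_cmul 2 y') \<in> carrier (relative_homology_group p ?U ?E)"
      "homologous_rel_set p ?U ?E 0 \<in> carrier (relative_homology_group p ?U ?E)"
      unfolding carrier_relative_homology_group using cyc singular_relcycle_0 by blast+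
  qed
  then have "singular_relboundary p ?U ?E (c - frag_cmul 2 y')"
    unfolding homologous_rel_set_eq by (simp add: homologous_rel_def)
  then show ?thesis
    using y'(1) by (auto simp: even_class_def singular_relcycle)
qed

text \<open>The connecting homomorphism respects doubling: if \<open>c - 2 y\<close> is a boundary
  plus a chain \<open>e\<close> of \<open>S\<close>, applying the boundary shows that
  \<open>e\<close> bounds the difference of the boundary of \<open>c\<close> and twice that of
  \<open>y\<close>.\<close>

lemma even_class_chain_boundary:
  assumes "singular_relcycle (Suc p) X S c" "even_class (Suc p) X S c"
  shows "even_class p (subtopology X S) {} (chain_boundary (Suc p) c)"
proof -
  obtain y where y: "singular_chain (Suc p) X y" "singular_relboundary (Suc p) X S (c - frag_cmul 2 y)"
    using assms(2) by (auto simp: even_class_def)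
  obtain d e where de: "singular_chain (Suc (Suc p)) X d" "singular_chain (Suc p) (subtopology X S) e"
      "chain_boundary (Suc (Suc p)) d + e = c - frag_cmul 2 y"
    using y(2) by (auto simp: singular_relboundary)
  have "singular_relcycle (Suc p) X S y"
    using assms(1) y singular_relcycle_diff_even by blast
  then have "singular_chain p (subtopology X S) (chain_boundary (Suc p) y)"
    by (simp add: singular_relcycle)
  moreover have "chain_boundary (Suc p) e = chain_boundary (Suc p) c - frag_cmul 2 (chain_boundary (Suc p) y)"
    using arg_cong[OF de(3), of "chain_boundary (Suc p)"] chain_boundary_boundary_alt[OF de(1)]
    by (simp add: chain_boundary_add chain_boundary_diff chain_boundary_cmul)
  ultimately show ?thesis
    using de(2) by (auto simp: even_class_def singular_boundary)
qed

lemma even_class_relativize: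
  assumes "even_class p X {} (c + c')" "singular_chain p (subtopology X S) c'"
  shows "even_class p X S c"
proof -
  obtain y d where y: "singular_chain p X y" and d: "singular_chain (Suc p) X d"
      "chain_boundary (Suc p) d = c + c' - frag_cmul 2 y"
    using assms(1) by (auto simp: even_class_def singular_boundary)
  have "singular_relboundary p X S (c - frag_cmul 2 y)"
    unfolding singular_relboundary_alt using d assms(2) by (intro exI[of _ d] exI[of _ c']) auto
  then show ?thesis using y by (auto simp: even_class_def)
qed

text \<open>On a one-point space the only boundary in degree 0 is 0, so the coefficient 1 of the
  point would have to be even.\<close>

lemma not_even_class_point:
  assumes "topspace X = {a}"
  shows "\<not> even_class 0 X {} (frag_of (restrict (\<lambda>x. a) (standard_simplex 0)))"
proof
  let ?s = "restrict (\<lambda>x. a) (standard_simplex 0)"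
  assume "even_class 0 X {} (frag_of ?s)"
  then obtain y where "singular_relboundary 0 X {} (frag_of ?s - frag_cmul 2 y)"
    by (auto simp: even_class_def)
  then have "frag_of ?s = frag_cmul 2 y"
    using assms by (simp add: singular_boundary_singleton)
  then have "poly_mapping.lookup (frag_of ?s) ?s = poly_mapping.lookup (frag_cmul 2 y) ?s" by simp
  then show False
    by simp presburger
qed


text \<open>A contraction makes \<open>z\<close> homologous to a cycle on a single point, which
  bounds in positive degree. In degree 0 the last hypothesis says that the coefficients of
  \<open>z\<close> sum to 0.\<close>

lemma singular_boundary_contractible_space:
  fixes X :: "'a topology"
  assumes X: "contractible_space X" and z: "singular_relcycle p X {} z"
    and 0: "\<And>a::'a. p = 0 \<Longrightarrow> chain_map 0 (\<lambda>_. a) z = 0"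
  shows "singular_relboundary p X {} z"
proof -
  obtain a where a: "homotopic_with (\<lambda>x. True) X X id (\<lambda>x. a)"
    using X by (auto simp: contractible_space_def)
  have "homologous_rel p X {} (chain_map p id z) (chain_map p (\<lambda>x. a) z)"
    using a z by (intro homotopic_imp_homologous_rel_chain_maps) auto
  moreover have "chain_map p id z = z"
    using z by (intro chain_map_ident) (auto simp: singular_relcycle)
  ultimately have h: "singular_relboundary p X {} (z - chain_map p (\<lambda>x. a) z)"
    by (simp add: homologous_rel_def)
  have "singular_relboundary p X {} (chain_map p (\<lambda>x. a) z)"
  proof (cases "p = 0 \<or> topspace X = {}")
    case True
    then show ?thesis
    proof
      assume "topspace X = {}"
      then have "z = 0"
        using z by (simp add: singular_relcycle singular_chain_empty)
      then show ?thesis by simp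
    qed (use 0 in auto)
  next
    case False
    then have top: "a \<in> topspace X"
      using homotopic_with_imp_continuous_maps[OF a] by (auto simp: continuous_map_def)
    have "singular_relcycle p (subtopology X {a}) {} (chain_map p (\<lambda>x. a) z)"
      using z top by (intro singular_relcycle_chain_map) (auto simp: continuous_map_in_subtopology)
    then have "singular_relboundary p (subtopology X {a}) {} (chain_map p (\<lambda>x. a) z)"
      using False top by (subst singular_boundary_eq_cycle_singleton[of _ a]) auto
    then have "singular_relboundary p (subtopology X UNIV) {} (chain_map p (\<lambda>x. a) z)"
      by (rule singular_boundary_mono[rotated]) auto
    then show ?thesis by simp
  qed
  from singular_relboundary_add[OF h this] show ?thesis by simp
qed

section \<open>A fundamental cycle compatible with the reflection\<close>

lemma simplex_map_restrict_const:
  "simplex_map p f (restrict (\<lambda>x. a) (standard_simplex p)) = restrict (\<lambda>x. f a) (standard_simplex p)"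
  by (auto simp: simplex_map_def)

text \<open>The cycle is a fundamental cycle. It is built by induction on the dimension: the cycle of the
  equator is filled by a chain \<open>c\<close> of the upper hemisphere, and the flipped chain, with the sign that
  cancels the boundary, fills it in the lower hemisphere.\<close>

lemma nsphere_flip_cycle:
  "\<exists>z e. (e = 1 \<or> e = -1) \<and> singular_relcycle k (nsphere k) {} z \<and> \<not> even_class k (nsphere k) {} z \<and>
     chain_map k axis_flip z = frag_cmul e z \<and>
     (if k = 0 then \<forall>a::nat \<Rightarrow> real. chain_map 0 (\<lambda>_. a) z = 0
      else \<exists>c. singular_chain k (nsphere k) c \<and> z = c + frag_cmul e (chain_map k axis_flip c))"
proof (induction k)
  case 0
  \<comment> \<open>The 0-sphere consists of \<open>P 1\<close> and \<open>P (-1)\<close>, both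
    fixed by the flip, so the induction starts with sign 1. Taking their difference makes the
    coefficients sum to 0, as needed to fill the cycle in the next dimension.\<close>
  define P where "P = (\<lambda>s i. if i = (0::nat) then s else (0::real))"
  define \<sigma> where "\<sigma> = (\<lambda>s. restrict (\<lambda>x::nat\<Rightarrow>real. P s) (standard_simplex 0))"
  have sing: "singular_simplex 0 X (\<sigma> s)" if "P s \<in> topspace X" for s X
    using that by (simp add: singular_simplex_def \<sigma>_def)
  have P: "P 1 \<in> topspace (nsphere 0)" "P (-1) \<in> topspace (nsphere 0)"
    by (auto simp: nsphere P_def)
  let ?z = "frag_of (\<sigma> 1) + - frag_of (\<sigma> (-1))"
  have cyc: "singular_relcycle 0 (nsphere 0) {} ?z"
    using P by (simp add: singular_cycle chain_boundary_def sing singular_chain_of singular_chain_diff)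
  have U: "topspace (subtopology (nsphere 0) {x. 0 \<le> x 0}) = {P 1}"
  proof -
    have "x = P 1" if "(x 0)\<^sup>2 = 1" "\<forall>i>0. x i = 0" "0 \<le> x 0" for x :: "nat \<Rightarrow> real"
      using that by (auto simp: P_def fun_eq_iff power2_eq_1_iff)
    then show ?thesis
      using P by (fastforce simp: nsphere P_def)
  qed
  have "\<not> even_class 0 (nsphere 0) {} ?z"
  proof
    assume "even_class 0 (nsphere 0) {} ?z"
    then have "even_class 0 (nsphere 0) {x. x 0 \<le> 0} (frag_of (\<sigma> 1))"
      by (rule even_class_relativize)
         (use P in \<open>auto simp: singular_chain_minus singular_chain_of P_def intro!: sing\<close>)
    then have "even_class 0 (subtopology (nsphere 0) {x. 0 \<le> x 0}) {x. x 0 = 0} (frag_of (\<sigma> 1))"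
      using U by (intro even_class_upper_hemisphere)
         (auto simp: singular_relcycle chain_boundary_def singular_chain_of intro!: sing)
    \<comment> \<open>The equator of the 0-sphere is empty, so the relative statement is an absolute
      one about the single point \<open>P 1\<close>.\<close>
    moreover have "topspace (subtopology (nsphere 0) {x. 0 \<le> x 0}) \<inter> {x. x 0 = 0} = {}"
      unfolding U by (auto simp: P_def)
    ultimately have "even_class 0 (subtopology (nsphere 0) {x. 0 \<le> x 0}) {} (frag_of (\<sigma> 1))"
      unfolding even_class_def by (metis singular_relboundary_restrict)
    then show False
      using not_even_class_point[OF U] by (simp add: \<sigma>_def)
  qed
  moreover have "chain_map 0 axis_flip ?z = frag_cmul 1 ?z"
  proof -
    have "axis_flip (P s) = P s" for s
      by (auto simp: axis_flip_def P_def)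
    then show ?thesis
      by (simp add: chain_map_diff \<sigma>_def simplex_map_restrict_const)
  qed
  moreover have "chain_map 0 (\<lambda>_. a) ?z = 0" for a :: "nat \<Rightarrow> real"
    by (simp add: chain_map_diff \<sigma>_def simplex_map_restrict_const)
  ultimately show ?case
    using cyc by (intro exI[of _ ?z] exI[of _ 1]) auto
next
  case (Suc k)
  then obtain z e where e: "e = 1 \<or> e = -1" and z: "singular_relcycle k (nsphere k) {} z"
    and nev: "\<not> even_class k (nsphere k) {} z" and flip: "chain_map k axis_flip z = frag_cmul e z"
    and if0: "if k = 0 then \<forall>a::nat \<Rightarrow> real. chain_map 0 (\<lambda>_. a) z = 0
      else \<exists>c. singular_chain k (nsphere k) c \<and> z = c + frag_cmul e (chain_map k axis_flip c)"
    by blast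
  let ?S = "nsphere (Suc k)"
  let ?U = "subtopology ?S {x. 0 \<le> x (Suc k)}" and ?E = "{x::nat\<Rightarrow>real. x (Suc k) = 0}"
    and ?L = "{x::nat\<Rightarrow>real. x (Suc k) \<le> 0}"
  have "{x::nat\<Rightarrow>real. 0 \<le> x (Suc k)} \<inter> ?E = ?E" by auto
  then have UE: "subtopology ?U ?E = nsphere k"
    by (simp add: subtopology_subtopology subtopology_nsphere_equator)
  have "singular_relcycle k (subtopology ?U ?E) {} z"
    using z by (simp add: UE)
  then have "singular_relcycle k (subtopology ?U UNIV) {} z"
    by (rule singular_cycle_mono) auto
  then have zU: "singular_relcycle k ?U {} z" by simp
  have "singular_relboundary k ?U {} z"
    using if0 by (intro singular_boundary_contractible_space[OF _ zU] contractible_space_upper_hemisphere) auto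
  then obtain c where c: "singular_chain (Suc k) ?U c" "chain_boundary (Suc k) c = z"
    by (auto simp: singular_boundary)
  have cS: "singular_chain (Suc k) ?S c"
    using c(1) by (simp add: singular_chain_subtopology)
  let ?f = "chain_map (Suc k) axis_flip"
  have cm: "continuous_map ?U (subtopology ?S ?L) axis_flip"
    using axis_flip_in_nsphere
    by (auto simp: continuous_map_in_subtopology intro: continuous_map_from_subtopology continuous_map_axis_flip)
  have fc: "singular_chain (Suc k) (subtopology ?S ?L) (?f c)"
    using singular_chain_chain_map[OF c(1) cm] .
  then have fcS: "singular_chain (Suc k) ?S (?f c)"
    by (simp add: singular_chain_subtopology)
  have ffc: "?f (?f c) = c"
  proof -
    have "?f (?f c) = chain_map (Suc k) (axis_flip \<circ> axis_flip) c"
      by (simp only: chain_map_compose o_apply)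
    also have "\<dots> = c"
      using cS by (rule chain_map_id_gen) simp
    finally show ?thesis .
  qed
  have ee: "e * e = 1" using e by auto
  \<comment> \<open>The flipped chain has boundary \<open>e z\<close>, so the factor
    \<open>- e\<close> cancels the boundary \<open>z\<close> of \<open>c\<close>, as
    \<open>e * e = 1\<close>. The same identity makes \<open>- e\<close> the sign by which the flip
    acts on the new cycle.\<close>
  let ?z = "c + frag_cmul (- e) (?f c)"
  have "chain_boundary (Suc k) ?z = 0"
    using chain_boundary_chain_map[OF c(1), of axis_flip]
    by (simp add: chain_boundary_add chain_boundary_cmul c(2) flip ee chain_boundary_minus)
  then have cyc: "singular_relcycle (Suc k) ?S {} ?z"
    using cS fcS by (simp add: singular_cycle singular_chain_add singular_chain_cmul)
  have "\<not> even_class (Suc k) ?S {} ?z"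
  proof
    \<comment> \<open>Modulo the lower hemisphere only \<open>c\<close> survives; moving to the
      upper hemisphere and taking boundaries would make the class of \<open>z\<close> even, against
      the induction hypothesis.\<close>
    assume "even_class (Suc k) ?S {} ?z"
    then have 1: "even_class (Suc k) ?S ?L c"
      using fc by (rule even_class_relativize[OF _ singular_chain_cmul])
    have 2: "singular_relcycle (Suc k) ?U ?E c"
      using c z UE by (simp add: singular_relcycle)
    have "even_class (Suc k) ?U ?E c"
      by (rule even_class_upper_hemisphere[OF 2 1])
    from even_class_chain_boundary[OF 2 this] show False
      using nev by (simp add: UE c(2))
  qed
  moreover have "?f ?z = frag_cmul (- e) ?z"
    using e by (auto simp: chain_map_add chain_map_diff ffc)
  ultimately show ?case
    using e cyc cS by (intro exI[of _ ?z] exI[of _ "-e"]) auto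
qed

text \<open>An invariant map has equal effect on both hemispherical halves of the fundamental cycle
  up to the sign \<open>e\<close>, so its image is \<open>1 + e\<close>, that is 2 or 0, times a
  chain; homotopy to the identity makes this image homologous to the cycle itself.\<close>

lemma not_homotopic_id_axis_flip_invariant:
  assumes f: "homotopic_with (\<lambda>x. True) (nsphere d) (nsphere d) f id" and "d > 0"
    and inv: "\<And>x. x \<in> topspace (nsphere d) \<Longrightarrow> f (axis_flip x) = f x"
  shows False
proof -
  let ?S = "nsphere d"
  obtain z e c where e: "e = 1 \<or> e = -1" and z: "singular_relcycle d ?S {} z"
    and nev: "\<not> even_class d ?S {} z"
    and c: "singular_chain d ?S c" "z = c + frag_cmul e (chain_map d axis_flip c)"
    using nsphere_flip_cycle[of d] \<open>d > 0\<close> by fastforce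
  have cf: "continuous_map ?S ?S f"
    using homotopic_with_imp_continuous_maps[OF f] by auto
  have "homologous_rel d ?S {} (chain_map d id z) (chain_map d f z)"
    using f z by (intro homotopic_imp_homologous_rel_chain_maps) (auto simp: homotopic_with_sym)
  moreover have "chain_map d id z = z"
    using z by (intro chain_map_ident) (auto simp: singular_relcycle)
  ultimately have h: "singular_relboundary d ?S {} (z - chain_map d f z)"
    by (simp add: homologous_rel_def)
  have "chain_map d f (chain_map d axis_flip c) = chain_map d (f \<circ> axis_flip) c"
    by (simp only: chain_map_compose o_apply)
  also have "\<dots> = chain_map d f c"
    using c(1) by (rule chain_map_eq) (simp add: inv)
  finally have "chain_map d f z = frag_cmul (1 + e) (chain_map d f c)"
    by (simp add: c(2) chain_map_add frag_cmul_distrib)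
  then have "chain_map d f z = frag_cmul 2 (if e = 1 then chain_map d f c else 0)"
    using e by auto
  moreover have "singular_chain d ?S (if e = 1 then chain_map d f c else 0)"
    using singular_chain_chain_map[OF c(1) cf] by auto
  ultimately have "even_class d ?S {} z"
    unfolding even_class_def using h by metis
  then show False using nev by simp
qed


section \<open>Zeros of reflection-invariant homotopies\<close>

lemma homotopic_with_normalized:
  fixes F :: "real \<Rightarrow> (nat \<Rightarrow> real) \<Rightarrow> nat \<Rightarrow> real"
  assumes cont: "\<And>i. i \<le> d \<Longrightarrow>
      continuous_map (prod_topology (top_of_set {0..1}) (nsphere d)) euclideanreal (\<lambda>p. F (fst p) (snd p) i)"
    and nz: "\<And>t z. t \<in> {0..1} \<Longrightarrow> z \<in> topspace (nsphere d) \<Longrightarrow> \<exists>i\<le>d. F t z i \<noteq> 0"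
  defines "N \<equiv> \<lambda>x i. if i \<le> d then x i / sqrt (\<Sum>j\<le>d. (x j)\<^sup>2) else (0::real)"
  shows "homotopic_with (\<lambda>x. True) (nsphere d) (nsphere d) (\<lambda>z. N (F 0 z)) (\<lambda>z. N (F 1 z))"
proof -
  \<comment> \<open>\<open>N\<close> is radial projection, continuous away from the origin;
    coordinates above \<open>d\<close> are set to 0 because points of \<open>nsphere d\<close>
    vanish there.\<close>
  let ?X = "prod_topology (top_of_set {0..1}) (nsphere d)"
  have pos: "(\<Sum>j\<le>d. (F (fst p) (snd p) j)\<^sup>2) > 0" if "p \<in> topspace ?X" for p
  proof -
    from that nz[of "fst p" "snd p"] obtain i where "i \<le> d" "F (fst p) (snd p) i \<noteq> 0" by auto
    then show ?thesis by (intro sum_pos2[of _ i]) auto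
  qed
  have "continuous_map ?X euclideanreal (\<lambda>p. N (F (fst p) (snd p)) i)" for i
  proof (cases "i \<le> d")
    case True
    have "continuous_map ?X euclideanreal
        (\<lambda>p. F (fst p) (snd p) i / sqrt (\<Sum>j\<le>d. (F (fst p) (snd p) j)\<^sup>2))"
      using pos True by (intro continuous_intros cont) (force simp: sum_nonneg)+
    then show ?thesis using True by (simp add: N_def)
  qed (simp add: N_def)
  then have 1: "continuous_map ?X (powertop_real UNIV) (\<lambda>p. N (F (fst p) (snd p)))"
    by (simp add: continuous_map_componentwise_UNIV)
  have 2: "(\<Sum>i\<le>d. (N (F (fst p) (snd p)) i)\<^sup>2) = 1" if "p \<in> topspace ?X" for p
  proof -
    have "(\<Sum>i\<le>d. (N (F (fst p) (snd p)) i)\<^sup>2)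
        = (\<Sum>i\<le>d. (F (fst p) (snd p) i)\<^sup>2 / (\<Sum>j\<le>d. (F (fst p) (snd p) j)\<^sup>2))"
      using pos[OF that] by (intro sum.cong) (auto simp: N_def power_divide)
    also have "\<dots> = 1"
      using pos[OF that] by (simp flip: sum_divide_distrib)
    finally show ?thesis .
  qed
  have "continuous_map ?X (nsphere d) (\<lambda>p. N (F (fst p) (snd p)))"
    using 1 2 by (subst (2) nsphere) (auto simp: continuous_map_in_subtopology N_def)
  then show ?thesis
    unfolding homotopic_with_def by (intro exI[of _ "\<lambda>p. N (F (fst p) (snd p))"]) auto
qed

text \<open>Without a zero, radial projection joins the invariant map at time 0 to the map at time
  1, and the segment of the last hypothesis joins that one to the identity, contradicting the
  previous result on invariant self-maps.\<close>

lemma axis_flip_invariant_homotopy_has_zero: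
  fixes F :: "real \<Rightarrow> (nat \<Rightarrow> real) \<Rightarrow> nat \<Rightarrow> real"
  assumes "d > 0"
    and cont: "\<And>i. i \<le> d \<Longrightarrow>
      continuous_map (prod_topology (top_of_set {0..1}) (nsphere d)) euclideanreal (\<lambda>p. F (fst p) (snd p) i)"
    and inv: "\<And>z i. z \<in> topspace (nsphere d) \<Longrightarrow> i \<le> d \<Longrightarrow> F 0 (axis_flip z) i = F 0 z i"
    and lin: "\<And>r z. r \<in> {0..1} \<Longrightarrow> z \<in> topspace (nsphere d) \<Longrightarrow> \<exists>i\<le>d. (1 - r) * F 1 z i + r * z i \<noteq> 0"
  shows "\<exists>t\<in>{0..<1}. \<exists>z\<in>topspace (nsphere d). \<forall>i\<le>d. F t z i = 0"
proof (rule ccontr)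
  assume neg: "\<not> ?thesis"
  define N where "N = (\<lambda>x i. if i \<le> d then x i / sqrt (\<Sum>j\<le>d. (x j)\<^sup>2) else (0::real))"
  \<comment> \<open>The time \<open>t = 1\<close> is covered by the start \<open>r = 0\<close> of
    the segment, which is why the zero can be found with \<open>t < 1\<close>.\<close>
  have "\<exists>i\<le>d. F t z i \<noteq> 0" if "t \<in> {0..1}" "z \<in> topspace (nsphere d)" for t z
  proof (cases "t = 1")
    case True
    then show ?thesis using lin[of 0 z] that by auto
  next
    case False
    then have "t \<in> {0..<1}" using that by auto
    then show ?thesis using neg that by blast
  qed
  from homotopic_with_normalized[where F = F, OF cont this]
  have h1: "homotopic_with (\<lambda>x. True) (nsphere d) (nsphere d) (\<lambda>z. N (F 0 z)) (\<lambda>z. N (F 1 z))"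
    by (simp add: N_def)
  let ?L = "\<lambda>r z i. (1 - r) * F 1 z i + r * z i"
  have F1: "continuous_map (nsphere d) euclideanreal (\<lambda>z. F 1 z i)" if "i \<le> d" for i
  proof -
    have "continuous_map (nsphere d) (prod_topology (top_of_set {0..1::real}) (nsphere d)) (\<lambda>z. (1, z))"
      by (auto simp: continuous_map_pairwise o_def)
    from continuous_map_compose[OF this cont[OF that]] show ?thesis
      by (simp add: o_def)
  qed
  have snd: "continuous_map (prod_topology (top_of_set {0..1}) (nsphere d)) euclideanreal (\<lambda>p. f (snd p))"
    if "continuous_map (nsphere d) euclideanreal f" for f :: "(nat \<Rightarrow> real) \<Rightarrow> real"
    using continuous_map_compose[OF continuous_map_snd that] by (simp add: o_def)
  have fst: "continuous_map (prod_topology (top_of_set {0..1}) (nsphere d)) euclideanreal fst"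
    using continuous_map_fst[of "top_of_set {0..1::real}" "nsphere d"]
    by (simp add: continuous_map_in_subtopology)
  have "continuous_map (prod_topology (top_of_set {0..1}) (nsphere d)) euclideanreal (\<lambda>p. ?L (fst p) (snd p) i)"
    if "i \<le> d" for i
    by (intro continuous_intros fst snd F1 that continuous_map_nsphere_projection)
  from homotopic_with_normalized[where F = ?L, OF this lin]
  have h2: "homotopic_with (\<lambda>x. True) (nsphere d) (nsphere d) (\<lambda>z. N (F 1 z)) (\<lambda>z. N z)"
    by (simp add: N_def cong: if_cong)
  have "N z = id z" if "z \<in> topspace (nsphere d)" for z
    using that by (auto simp: nsphere N_def fun_eq_iff)
  then have "homotopic_with (\<lambda>x. True) (nsphere d) (nsphere d) (\<lambda>z. N (F 1 z)) id"
    using h2 by (rule_tac homotopic_with_eq[OF h2]) auto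
  with h1 have "homotopic_with (\<lambda>x. True) (nsphere d) (nsphere d) (\<lambda>z. N (F 0 z)) id"
    by (rule homotopic_with_trans)
  moreover have "N (F 0 (axis_flip z)) = N (F 0 z)" if "z \<in> topspace (nsphere d)" for z
    using inv[OF that] by (auto simp: N_def fun_eq_iff intro!: arg_cong2[where f = "(/)"] sum.cong)
  ultimately show False
    using not_homotopic_id_axis_flip_invariant \<open>d > 0\<close> by blast
qed

section \<open>Measures of slabs\<close>

text \<open>By second countability, the complement of the support is covered by countably many basic
  open null sets.\<close>

lemma AE_measure_support:
  fixes M :: "'a::second_countable_topology measure"
  assumes "sets M = sets borel"
  shows "AE x in M. x \<in> measure_support M"
proof -
  obtain B :: "'a set set" where B: "countable B" "topological_basis B"
    using ex_countable_basis by blast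
  let ?N = "\<Union>{U \<in> B. emeasure M U = 0}"
  have N: "?N \<in> null_sets M"
    using B assms by (intro null_sets_UN'[of _ id, simplified])
      (auto simp: null_sets_def intro!: borel_open topological_basis_open)
  show ?thesis
  proof (rule AE_I'[OF N], safe)
    fix x assume "x \<notin> measure_support M"
    then obtain U where "open U" "x \<in> U" "emeasure M U = 0"
      by (auto simp: measure_support_def)
    moreover then obtain V where "V \<in> B" "x \<in> V" "V \<subseteq> U"
      using B(2) topological_basisE by blast
    moreover have "emeasure M V \<le> emeasure M U"
      using \<open>V \<subseteq> U\<close> \<open>open U\<close> assms by (intro emeasure_mono) auto
    ultimately show "x \<in> ?N" by auto
  qed
qed

text \<open>The case of a zero normal with nonzero constant, where the set is empty, is included
  because the family of slabs passes through zero normals.\<close>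

lemma null_sets_hyperplane:
  fixes v :: "'a::euclidean_space"
  assumes "absolutely_continuous lborel M" "v \<noteq> 0 \<or> b \<noteq> 0"
  shows "{x. v \<bullet> x = b} \<in> null_sets M"
proof -
  have "closed {x. v \<bullet> x = b}"
    by (intro closed_Collect_eq continuous_intros)
  moreover have "negligible {x. v \<bullet> x = b}"
    using assms(2) by (cases "v = 0") (auto intro: negligible_hyperplane)
  ultimately have "{x. v \<bullet> x = b} \<in> null_sets lborel"
    by (simp add: negligible_iff_null_sets null_sets_completion_iff borel_closed)
  then show ?thesis
    using assms(1) by (auto simp: absolutely_continuous_def)
qed

text \<open>The two bounding functionals are allowed to be zero as long as the corresponding constraint
  is not the borderline case \<open>0 \<le> 0\<close>.\<close>

lemma tendsto_measure_slab:
  fixes M :: "'a::euclidean_space measure"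
  assumes M: "finite_measure M" "sets M = sets borel" "absolutely_continuous lborel M"
    and lim: "(v \<longlongrightarrow> v0) sequentially" "(b \<longlongrightarrow> b0) sequentially"
      "(w \<longlongrightarrow> w0) sequentially" "(a \<longlongrightarrow> a0) sequentially"
    and ne: "v0 \<noteq> 0 \<or> b0 \<noteq> 0" "w0 \<noteq> 0 \<or> a0 \<noteq> 0"
  shows "(\<lambda>n. measure M {x. v n \<bullet> x \<le> b n \<and> a n \<le> w n \<bullet> x})
           \<longlonglongrightarrow> measure M {x. v0 \<bullet> x \<le> b0 \<and> a0 \<le> w0 \<bullet> x}"
proof -
  interpret finite_measure M by fact
  have meas [measurable]: "{x. v' \<bullet> x \<le> b' \<and> a' \<le> w' \<bullet> x} \<in> sets M" for v' w' :: 'a and a' b'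
    unfolding M(2) by (intro borel_closed closed_Collect_conj closed_Collect_le continuous_intros)
  \<comment> \<open>Off the two limiting hyperplanes, which are null, the truth value of each
    constraint is eventually constant, so the indicators converge almost everywhere and dominated
    convergence applies.\<close>
  have AE: "AE x in M. v0 \<bullet> x \<noteq> b0 \<and> w0 \<bullet> x \<noteq> a0"
    using null_sets_hyperplane[OF M(3) ne(1)] null_sets_hyperplane[OF M(3) ne(2)]
    by (auto simp: AE_iff_null_sets[symmetric] dest!: AE_not_in)
  have "(\<lambda>n. integral\<^sup>L M (indicat_real {x. v n \<bullet> x \<le> b n \<and> a n \<le> w n \<bullet> x}))
      \<longlonglongrightarrow> integral\<^sup>L M (indicat_real {x. v0 \<bullet> x \<le> b0 \<and> a0 \<le> w0 \<bullet> x})"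
  proof (rule integral_dominated_convergence[where w = "\<lambda>_. 1"])
    show "AE x in M. (\<lambda>n. indicat_real {x. v n \<bullet> x \<le> b n \<and> a n \<le> w n \<bullet> x} x)
        \<longlonglongrightarrow> indicat_real {x. v0 \<bullet> x \<le> b0 \<and> a0 \<le> w0 \<bullet> x} x"
      using AE
    proof eventually_elim
      case (elim x)
      have l1: "(\<lambda>n. v n \<bullet> x) \<longlonglongrightarrow> v0 \<bullet> x" and l2: "(\<lambda>n. w n \<bullet> x) \<longlonglongrightarrow> w0 \<bullet> x"
        by (intro tendsto_intros lim)+
      have 1: "\<forall>\<^sub>F n in sequentially. (v n \<bullet> x \<le> b n) = (v0 \<bullet> x \<le> b0)"
      proof (cases "v0 \<bullet> x < b0")
        case True
        then show ?thesis
          using order_tendstoD(1)[OF tendsto_diff[OF lim(2) l1], of 0] by (auto elim: eventually_mono)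
      next
        case False
        then show ?thesis
          using elim order_tendstoD(2)[OF tendsto_diff[OF lim(2) l1], of 0] by (auto elim: eventually_mono)
      qed
      have 2: "\<forall>\<^sub>F n in sequentially. (a n \<le> w n \<bullet> x) = (a0 \<le> w0 \<bullet> x)"
      proof (cases "a0 < w0 \<bullet> x")
        case True
        then show ?thesis
          using order_tendstoD(1)[OF tendsto_diff[OF l2 lim(4)], of 0] by (auto elim: eventually_mono)
      next
        case False
        then show ?thesis
          using elim order_tendstoD(2)[OF tendsto_diff[OF l2 lim(4)], of 0] by (auto elim: eventually_mono)
      qed
      from 1 2 have "\<forall>\<^sub>F n in sequentially. indicat_real {x. v n \<bullet> x \<le> b n \<and> a n \<le> w n \<bullet> x} x =
          indicat_real {x. v0 \<bullet> x \<le> b0 \<and> a0 \<le> w0 \<bullet> x} x"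
        by eventually_elim (simp add: indicator_def)
      then show ?case by (rule tendsto_eventually)
    qed
  qed (auto simp: indicator_def)
  then show ?thesis by simp
qed

text \<open>Intermediate value theorem on symmetric slabs around a hyperplane through the origin.
  The angle as parameter reaches the whole space at the finite value \<open>pi/2\<close>, while at 0
  the slab is a null hyperplane.\<close>

lemma ex_slab_single_measure:
  fixes M :: "'a::euclidean_space measure"
  assumes M: "finite_measure M" "sets M = sets borel" "absolutely_continuous lborel M"
    and \<alpha>: "0 < \<alpha>" "\<alpha> < 1" and pos: "measure M UNIV > 0"
  shows "\<exists>u a b. u \<noteq> 0 \<and> a < b \<and> measure M {x. a \<le> u \<bullet> x \<and> u \<bullet> x \<le> b} = \<alpha> * measure M UNIV"
proof -
  obtain e :: 'a where e: "e \<noteq> 0"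
    using nonempty_Basis nonzero_Basis by blast
  define f where "f = (\<lambda>\<theta>. measure M {x. (cos \<theta> *\<^sub>R e) \<bullet> x \<le> sin \<theta> \<and> - sin \<theta> \<le> (cos \<theta> *\<^sub>R e) \<bullet> x})"
  have "continuous_on {0..pi/2} f"
    unfolding continuous_on_sequentially f_def o_def
  proof (intro allI ballI impI)
    fix \<theta> :: real and \<theta>n assume *: "\<theta> \<in> {0..pi/2}" "(\<forall>n. \<theta>n n \<in> {0..pi / 2}) \<and> \<theta>n \<longlonglongrightarrow> \<theta>"
    have "cos \<theta> \<noteq> 0 \<or> sin \<theta> \<noteq> 0"
      using sin_cos_squared_add[of \<theta>] by (auto simp del: sin_cos_squared_add)
    then show "(\<lambda>n. measure M {x. (cos (\<theta>n n) *\<^sub>R e) \<bullet> x \<le> sin (\<theta>n n) \<and> - sin (\<theta>n n) \<le> (cos (\<theta>n n) *\<^sub>R e) \<bullet> x})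
         \<longlonglongrightarrow> measure M {x. (cos \<theta> *\<^sub>R e) \<bullet> x \<le> sin \<theta> \<and> - sin \<theta> \<le> (cos \<theta> *\<^sub>R e) \<bullet> x}"
      using * e by (intro tendsto_measure_slab[OF M] tendsto_intros) auto
  qed
  moreover have f0: "f 0 = 0"
  proof -
    have "{x. (cos 0 *\<^sub>R e) \<bullet> x \<le> sin 0 \<and> - sin 0 \<le> (cos 0 *\<^sub>R e) \<bullet> x} = {x. e \<bullet> x = 0}" by auto
    then show ?thesis
      unfolding f_def using null_sets_hyperplane[OF M(3), of e 0] e by (simp add: null_setsD1 measure_def)
  qed
  moreover have f1: "f (pi/2) = measure M UNIV"
    by (simp add: f_def)
  ultimately obtain \<theta> where \<theta>: "0 \<le> \<theta>" "\<theta> \<le> pi/2" "f \<theta> = \<alpha> * measure M UNIV"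
    using IVT'[of f 0 "\<alpha> * measure M UNIV" "pi/2"] \<alpha> pos by auto
  then have "f \<theta> \<noteq> f 0" "f \<theta> \<noteq> f (pi/2)"
    using f0 f1 \<alpha> pos by auto
  then have "\<theta> \<noteq> 0" "\<theta> \<noteq> pi/2"
    by metis+
  then have "cos \<theta> > 0" "sin \<theta> > 0"
    using \<theta> by (auto intro!: cos_gt_zero sin_gt_zero)
  moreover have "{x. - sin \<theta> \<le> (cos \<theta> *\<^sub>R e) \<bullet> x \<and> (cos \<theta> *\<^sub>R e) \<bullet> x \<le> sin \<theta>} =
     {x. (cos \<theta> *\<^sub>R e) \<bullet> x \<le> sin \<theta> \<and> - sin \<theta> \<le> (cos \<theta> *\<^sub>R e) \<bullet> x}" by auto
  ultimately show ?thesis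
    using \<theta>(3) e unfolding f_def
    by (intro exI[of _ "cos \<theta> *\<^sub>R e"] exI[of _ "- sin \<theta>"] exI[of _ "sin \<theta>"]) auto
qed

section \<open>Slabs for separated measures\<close>

text \<open>\<open>U I\<close> and \<open>C I\<close> are chosen separators with the supports of
  \<open>I\<close> on the low side. The number \<open>d + 1\<close> counts the measures of positive
  mass and is not tied to the dimension of the space.\<close>

locale separated_measures =
  fixes d :: nat and M :: "nat \<Rightarrow> 'a::euclidean_space measure" and K :: "nat \<Rightarrow> 'a set"
    and U :: "nat set \<Rightarrow> 'a" and C :: "nat set \<Rightarrow> real" and \<alpha> :: "nat \<Rightarrow> real"
  assumes d: "d > 0"
    and finite: "i \<le> d \<Longrightarrow> finite_measure (M i)"
    and sets: "i \<le> d \<Longrightarrow> sets (M i) = sets borel"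
    and ac: "i \<le> d \<Longrightarrow> absolutely_continuous lborel (M i)"
    and mass: "i \<le> d \<Longrightarrow> measure (M i) UNIV > 0"
    and AE_K: "i \<le> d \<Longrightarrow> AE x in M i. x \<in> K i"
    and U_nonzero: "\<lbrakk>I \<subset> {..d}; I \<noteq> {}\<rbrakk> \<Longrightarrow> U I \<noteq> 0"
    and sep_le: "\<lbrakk>I \<subset> {..d}; I \<noteq> {}; i \<in> I; x \<in> K i\<rbrakk> \<Longrightarrow> U I \<bullet> x \<le> C I"
    and sep_ge: "\<lbrakk>I \<subset> {..d}; I \<noteq> {}; i \<in> {..d} - I; x \<in> K i\<rbrakk> \<Longrightarrow> C I \<le> U I \<bullet> x"
    and \<alpha>: "i \<le> d \<Longrightarrow> 0 < \<alpha> i \<and> \<alpha> i < 1"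
begin

text \<open>Pinning measure 0 at position 0 makes the lowest position nonpositive and the highest
  nonnegative; the coordinate \<open>z 0\<close> is thus free to serve as the width of the slab.\<close>

definition pos :: "(nat \<Rightarrow> real) \<Rightarrow> nat \<Rightarrow> real" where
  "pos z i = (if i = 0 then 0 else z i)"

text \<open>\<open>gap I y\<close> is positive exactly when all positions in \<open>I\<close> lie below all others, so only separators
  compatible with the order of the positions contribute to \<open>normal\<close> and \<open>offset\<close>.\<close>

definition gap :: "nat set \<Rightarrow> (nat \<Rightarrow> real) \<Rightarrow> real" where
  "gap I y = (\<Prod>i\<in>I. \<Prod>j\<in>{..d} - I. max 0 (y j - y i))"

text \<open>The difference makes the coefficient odd under reversal of the positions. For
  \<open>I\<close> in \<open>parts\<close> at most one term is nonzero: the separator is used as it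
  is when \<open>I\<close> lies lowest, and reversed when \<open>I\<close> lies highest.\<close>

definition coef :: "nat set \<Rightarrow> (nat \<Rightarrow> real) \<Rightarrow> real" where
  "coef I z = gap I (pos z) - gap I (\<lambda>i. - pos z i)"

abbreviation parts :: "nat set set" where
  "parts \<equiv> {I. I \<subset> {..d} \<and> I \<noteq> {}}"

definition normal :: "(nat \<Rightarrow> real) \<Rightarrow> 'a" where
  "normal z = (\<Sum>I\<in>parts. coef I z *\<^sub>R U I)"

definition offset :: "(nat \<Rightarrow> real) \<Rightarrow> real" where
  "offset z = (\<Sum>I\<in>parts. coef I z * C I)"

text \<open>With \<open>g x = normal z \<bullet> x - offset z\<close> and \<open>z 0 \<ge> 0\<close>, this interpolates between the slab
  \<open>\<bar>g x\<bar> \<le> z 0\<close> at \<open>t = 0\<close> and the half-space \<open>g x \<le> z 0\<close> at \<open>t = 1\<close>.\<close>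

definition slab :: "real \<Rightarrow> (nat \<Rightarrow> real) \<Rightarrow> 'a set" where
  "slab t z = {x. normal z \<bullet> x \<le> offset z + z 0 \<and>
                  (1 - t) * (offset z - \<bar>z 0\<bar>) - t \<le> ((1 - t) *\<^sub>R normal z) \<bullet> x}"

definition excess :: "real \<Rightarrow> (nat \<Rightarrow> real) \<Rightarrow> nat \<Rightarrow> real" where
  "excess t z i = measure (M i) (slab t z) - \<alpha> i * measure (M i) UNIV"

section \<open>Symmetry, signs and nondegeneracy of the affine functional\<close>

lemma pos_0 [simp]: "pos z 0 = 0"
  by (simp add: pos_def)

lemma pos_flip [simp]: "pos (axis_flip z) i = - pos z i"
  by (simp add: pos_def axis_flip_def)

lemma pos_flip': "pos (axis_flip z) = (\<lambda>i. - pos z i)"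
  by auto

lemma coef_flip: "coef I (axis_flip z) = - coef I z"
  by (simp add: coef_def pos_flip')

lemma normal_flip: "normal (axis_flip z) = - normal z"
  by (simp add: normal_def coef_flip sum_negf)

lemma offset_flip: "offset (axis_flip z) = - offset z"
  by (simp add: offset_def coef_flip sum_negf)

lemma finite_parts: "finite parts"
  by (rule finite_subset[of _ "Pow {..d}"]) auto

lemma gap_nonneg: "gap I y \<ge> 0"
  unfolding gap_def by (intro prod_nonneg) auto

lemma gap_eq_0:
  assumes "i \<in> I" "j \<in> {..d} - I" "y j \<le> y i" "I \<in> parts"
  shows "gap I y = 0"
proof -
  have "finite I" using assms(4) finite_subset by blast
  moreover have "(\<Prod>j\<in>{..d} - I. max 0 (y j - y i)) = 0"
    using assms(2,3) by (intro prod_zero) (auto intro!: bexI[of _ j])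
  ultimately show ?thesis
    unfolding gap_def using assms(1) by (intro prod_zero) auto
qed

text \<open>If \<open>i\<close> belongs to \<open>I\<close>, its lowest position rules out that
  \<open>I\<close> lies above the rest, so the coefficient is nonnegative and the separator factor
  nonpositive; otherwise both signs are reversed.\<close>

lemma term_nonpos:
  assumes i: "i \<le> d" "\<And>j. j \<le> d \<Longrightarrow> pos z i \<le> pos z j" and x: "x \<in> K i" and I: "I \<in> parts"
  shows "coef I z * (U I \<bullet> x - C I) \<le> 0"
proof (cases "i \<in> I")
  case True
  obtain j where "j \<in> {..d} - I" using I by blast
  then have "gap I (\<lambda>i. - pos z i) = 0"
    using i True I by (intro gap_eq_0[of i _ j]) auto
  then show ?thesis
    using sep_le[of I i x] I True x gap_nonneg by (auto simp: coef_def intro!: mult_nonneg_nonpos)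
next
  case False
  obtain i' where "i' \<in> I" using I by blast
  then have "gap I (pos z) = 0"
    using i False I by (intro gap_eq_0[of i' _ i]) auto
  then show ?thesis
    using sep_ge[of I i x] I i False x gap_nonneg[of I] by (auto simp: coef_def intro!: mult_nonneg_nonneg)
qed

lemma affine_eq: "normal z \<bullet> x - offset z = (\<Sum>I\<in>parts. coef I z * (U I \<bullet> x - C I))"
  by (simp add: normal_def offset_def inner_sum_left sum_subtractf[symmetric] algebra_simps)

lemma normal_argmin:
  assumes "i \<le> d" "\<And>j. j \<le> d \<Longrightarrow> pos z i \<le> pos z j" "x \<in> K i"
  shows "normal z \<bullet> x \<le> offset z"
proof -
  have "normal z \<bullet> x - offset z \<le> 0"
    unfolding affine_eq by (intro sum_nonpos term_nonpos[OF assms])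
  then show ?thesis by simp
qed

text \<open>Reversing the positions exchanges lowest with highest and negates the
  functional.\<close>

lemma normal_argmax:
  assumes "i \<le> d" "\<And>j. j \<le> d \<Longrightarrow> pos z j \<le> pos z i" "x \<in> K i"
  shows "offset z \<le> normal z \<bullet> x"
  using normal_argmin[of i "axis_flip z" x] assms by (simp add: normal_flip offset_flip)

lemma AE_nonempty:
  assumes "i \<le> d" "AE x in M i. P x"
  shows "\<exists>x. P x"
proof (rule ccontr)
  assume "\<not> ?thesis"
  then have "AE x in M i. False" using assms(2) by auto
  moreover have "space (M i) = UNIV"
    using sets_eq_imp_space_eq[OF sets[OF assms(1)]] by simp
  ultimately have "UNIV \<in> null_sets (M i)"
    by (metis AE_iff_null_sets UNIV_I eventually_mono sets.top AE_not_in iso_tuple_UNIV_I)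
  then have "measure (M i) UNIV = 0"
    by (simp add: measure_def null_setsD1)
  then show False using mass[OF assms(1)] by simp
qed

lemma ex_argmin: "\<exists>i\<le>d. \<forall>j\<le>d. pos z i \<le> (pos z j :: real)"
proof -
  have "Min (pos z ` {..d}) \<in> pos z ` {..d}" by (intro Min_in) auto
  then obtain i where "i \<le> d" "Min (pos z ` {..d}) = pos z i"
    by (metis atMost_iff imageE)
  then show ?thesis
    by (metis Min_le atMost_iff finite_atMost finite_imageI imageI)
qed

lemma ex_argmax: "\<exists>i\<le>d. \<forall>j\<le>d. pos z j \<le> (pos z i :: real)"
  using ex_argmin[of "axis_flip z"] by simp

text \<open>With a zero normal, the signs on the lowest and the highest support force the offset to
  be 0. Then every term of the functional vanishes on the lowest support, and a term with positive
  coefficient confines that support to a hyperplane, impossible for an absolutely continuous measure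
  of positive mass.\<close>

lemma normal_nonzero:
  assumes "k \<le> d" "pos z k \<noteq> 0"
  shows "normal z \<noteq> 0"
proof
  assume 0: "normal z = 0"
  obtain i where i: "i \<le> d" "\<And>j. j \<le> d \<Longrightarrow> pos z i \<le> pos z j" using ex_argmin by blast
  obtain j where j: "j \<le> d" "\<And>i. i \<le> d \<Longrightarrow> pos z i \<le> pos z j" using ex_argmax by blast
  have lt: "pos z i < pos z j"
    using i(2)[of 0] i(2)[of k] j(2)[of 0] j(2)[of k] assms by fastforce
  obtain x y where "x \<in> K i" "y \<in> K j"
    using AE_nonempty[OF i(1) AE_K] AE_nonempty[OF j(1) AE_K] i j by blast
  then have off: "offset z = 0"
    using normal_argmin[OF i, of x] normal_argmax[OF j, of y] 0 by simp
  \<comment> \<open>All indices tied for the lowest position are taken, so that the complement lies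
    strictly above and the gap is positive.\<close>
  define I where "I = {l. l \<le> d \<and> pos z l \<le> pos z i}"
  have ij: "i \<in> I" "j \<in> {..d} - I"
    using i(1) j(1) lt by (auto simp: I_def)
  moreover have "I \<subseteq> {..d}" by (auto simp: I_def)
  ultimately have I: "I \<in> parts" by blast
  have "gap I (pos z) > 0"
    unfolding gap_def by (intro prod_pos) (auto simp: I_def)
  moreover have "gap I (\<lambda>i. - pos z i) = 0"
    using I ij lt by (intro gap_eq_0[of i _ j]) auto
  ultimately have coef: "coef I z > 0" by (simp add: coef_def)
  have hyp: "U I \<bullet> x = C I" if "x \<in> K i" for x
  proof -
    have "(\<Sum>I\<in>parts. - (coef I z * (U I \<bullet> x - C I))) = 0"
      using affine_eq[of z x] 0 off by (simp add: sum_negf)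
    moreover have "- (coef I z * (U I \<bullet> x - C I)) \<ge> 0" if "I \<in> parts" for I
      using term_nonpos[OF i \<open>x \<in> K i\<close> that] by simp
    ultimately have "- (coef I z * (U I \<bullet> x - C I)) = 0"
      using sum_nonneg_0[OF finite_parts, of "\<lambda>I. - (coef I z * (U I \<bullet> x - C I))"] I by blast
    then show ?thesis using coef by simp
  qed
  have "AE x in M i. U I \<bullet> x \<noteq> C I"
    using null_sets_hyperplane[OF ac[OF i(1)], of "U I" "C I"] U_nonzero[of I] I
    by (auto dest!: AE_not_in)
  with AE_K[OF i(1)] have "AE x in M i. False"
    by eventually_elim (use hyp in auto)
  then show False using AE_nonempty[OF i(1), of "\<lambda>_. False"] by blast
qed

text \<open>If all positions vanish, the point is a pole of the sphere and every gap is 0. This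
  keeps the bounding constraints away from the borderline case \<open>0 \<le> 0\<close>.\<close>

lemma nondegenerate:
  assumes "z \<in> topspace (nsphere d)"
  shows "normal z \<noteq> 0 \<or> \<bar>z 0\<bar> = 1 \<and> offset z = 0"
proof (cases "\<exists>k\<le>d. pos z k \<noteq> 0")
  case True
  then show ?thesis using normal_nonzero by blast
next
  case False
  then have z: "pos z k = 0" if "k \<le> d" for k using that by auto
  have "(z 0)\<^sup>2 = (\<Sum>i\<le>d. (if i = 0 then (z 0)\<^sup>2 else 0))"
    by simp
  also have "\<dots> = (\<Sum>i\<le>d. (z i)\<^sup>2)"
  proof (intro sum.cong refl)
    show "(if i = 0 then (z 0)\<^sup>2 else 0) = (z i)\<^sup>2" if "i \<in> {..d}" for i
      using z[of i] that by (auto simp: pos_def)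
  qed
  also have "\<dots> = 1" using assms by (simp add: nsphere)
  finally have "\<bar>z 0\<bar> = 1" by (simp add: abs_square_eq_1 power2_eq_1_iff abs_if)
  moreover have "coef I z = 0" if I: "I \<in> parts" for I
  proof -
    obtain i j where "i \<in> I" "j \<in> {..d} - I" using I by blast
    then have "gap I (pos z) = 0" "gap I (\<lambda>i. - pos z i) = 0"
      using I z by (intro gap_eq_0[of i _ j]; force)+
    then show ?thesis by (simp add: coef_def)
  qed
  then have "offset z = 0" by (simp add: offset_def)
  ultimately show ?thesis by simp
qed

section \<open>Continuity of the excess\<close>

lemma continuous_on_coordinates:
  fixes A :: "(real \<times> (nat \<Rightarrow> real)) set"
  shows "continuous_on A (\<lambda>p. snd p i)"
  by (rule continuous_on_product_then_coordinatewise[OF continuous_on_snd[OF continuous_on_id]])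

lemma continuous_on_coef:
  fixes A :: "(real \<times> (nat \<Rightarrow> real)) set"
  shows "continuous_on A (\<lambda>p. coef I (snd p))"
proof -
  have "continuous_on A (\<lambda>p. pos (snd p) i)" for i
    by (cases "i = 0") (auto simp: pos_def intro: continuous_on_coordinates)
  then show ?thesis
    unfolding coef_def gap_def
    by (intro continuous_on_diff continuous_on_prod continuous_on_max continuous_on_minus continuous_on_const) auto
qed

lemma continuous_on_excess:
  assumes i: "i \<le> d"
  shows "continuous_on ({0..1} \<times> topspace (nsphere d)) (\<lambda>p. excess (fst p) (snd p) i)"
proof -
  let ?A = "{0..1::real} \<times> topspace (nsphere d)"
  let ?b = "\<lambda>p. offset (snd p) + snd p 0" and ?w = "\<lambda>p. (1 - fst p) *\<^sub>R normal (snd p)"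
    and ?a = "\<lambda>p. (1 - fst p) * (offset (snd p) - \<bar>snd p 0\<bar>) - fst p"
  have n: "continuous_on ?A (\<lambda>p. normal (snd p))"
    unfolding normal_def by (intro continuous_on_sum continuous_on_scaleR continuous_on_const continuous_on_coef)
  have off: "continuous_on ?A (\<lambda>p. offset (snd p))"
    unfolding offset_def by (intro continuous_on_sum continuous_on_mult continuous_on_const continuous_on_coef)
  have b: "continuous_on ?A ?b" and w: "continuous_on ?A ?w" and a: "continuous_on ?A ?a"
    by (intro continuous_intros n off continuous_on_coordinates)+
  have "continuous_on ?A (\<lambda>p. measure (M i) (slab (fst p) (snd p)))"
    unfolding continuous_on_sequentially
  proof (intro allI ballI impI)
    fix p pn assume p: "p \<in> ?A" and pn: "(\<forall>n. pn n \<in> ?A) \<and> pn \<longlonglongrightarrow> p"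
    have lim: "(\<lambda>n. f (pn n)) \<longlonglongrightarrow> f p" if "continuous_on ?A f"
      for f :: "real \<times> (nat \<Rightarrow> real) \<Rightarrow> 'b::topological_space"
      using that p pn by (auto simp: continuous_on_sequentially o_def)
    have nd: "normal (snd p) \<noteq> 0 \<or> \<bar>snd p 0\<bar> = 1 \<and> offset (snd p) = 0"
      using p by (intro nondegenerate) auto
    have "(\<lambda>n. measure (M i) {x. normal (snd (pn n)) \<bullet> x \<le> ?b (pn n) \<and> ?a (pn n) \<le> ?w (pn n) \<bullet> x})
        \<longlonglongrightarrow> measure (M i) {x. normal (snd p) \<bullet> x \<le> ?b p \<and> ?a p \<le> ?w p \<bullet> x}"
    proof (rule tendsto_measure_slab[OF finite[OF i] sets[OF i] ac[OF i] lim[OF n] lim[OF b] lim[OF w] lim[OF a]])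
      \<comment> \<open>At the poles the upper bound is 1 or -1. The lower bound is -1 both at the
        poles and at time 1, thanks to the summand \<open>- t\<close> in the definition of the
        slab.\<close>
      show "normal (snd p) \<noteq> 0 \<or> ?b p \<noteq> 0" using nd by auto
      show "?w p \<noteq> 0 \<or> ?a p \<noteq> 0" using nd by (cases "fst p = 1") auto
    qed
    then show "((\<lambda>p. measure (M i) (slab (fst p) (snd p))) \<circ> pn)
        \<longlonglongrightarrow> measure (M i) (slab (fst p) (snd p))"
      by (simp add: slab_def o_def)
  qed
  then show ?thesis
    unfolding excess_def by (intro continuous_intros)
qed

section \<open>The two ends of the deformation\<close>

lemma measure_hyperplane:
  assumes "i \<le> d" "v \<noteq> 0 \<or> b \<noteq> 0"
  shows "measure (M i) {x. v \<bullet> x = b} = 0"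
  using null_sets_hyperplane[OF ac[OF assms(1)] assms(2)] by (simp add: measure_def null_setsD1)

text \<open>For \<open>z 0 \<ge> 0\<close> the flip merely swaps the two constraints. For
  \<open>z 0 < 0\<close> the absolute value in the lower bound collapses both slabs to hyperplanes,
  which are null.\<close>

lemma excess_flip:
  assumes z: "z \<in> topspace (nsphere d)" and i: "i \<le> d"
  shows "excess 0 (axis_flip z) i = excess 0 z i"
proof (cases "z 0 \<ge> 0")
  case True
  then have "slab 0 (axis_flip z) = slab 0 z"
    by (auto simp: slab_def normal_flip offset_flip)
  then show ?thesis by (simp add: excess_def)
next
  case False
  then have "slab 0 (axis_flip z) = {x. normal z \<bullet> x = offset z - z 0}"
      "slab 0 z = {x. normal z \<bullet> x = offset z + z 0}"
    by (auto simp: slab_def normal_flip offset_flip)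
  moreover have "measure (M i) {x. normal z \<bullet> x = offset z - z 0} = 0"
      "measure (M i) {x. normal z \<bullet> x = offset z + z 0} = 0"
    using nondegenerate[OF z] by (intro measure_hyperplane[OF i]; auto)+
  ultimately show ?thesis by (simp add: excess_def)
qed

lemma slab_in_sets: "i \<le> d \<Longrightarrow> slab t z \<in> sets (M i)"
  unfolding sets slab_def
  by (intro borel_closed closed_Collect_conj closed_Collect_le continuous_intros)

lemma excess_halfspace_argmin:
  assumes i: "i \<le> d" "\<And>j. j \<le> d \<Longrightarrow> pos z i \<le> pos z j" and z: "z 0 \<ge> 0"
  shows "excess 1 z i > 0"
proof -
  have "AE x in M i. x \<in> slab 1 z"
    using AE_K[OF i(1)]
  proof eventually_elim
    case (elim x)
    then show ?case using normal_argmin[OF i, of x] z by (simp add: slab_def)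
  qed
  then have "measure (M i) (slab 1 z) = measure (M i) UNIV"
    using slab_in_sets[OF i(1)] sets[OF i(1)]
    by (intro finite_measure.finite_measure_eq_AE finite i) auto
  then show ?thesis
    using mass[OF i(1)] \<alpha>[OF i(1)] by (simp add: excess_def)
qed

lemma excess_halfspace_argmax:
  assumes i: "i \<le> d" "\<And>j. j \<le> d \<Longrightarrow> pos z j \<le> pos z i" and z: "z 0 < 0"
  shows "excess 1 z i < 0"
proof -
  have "AE x in M i. x \<notin> slab 1 z"
    using AE_K[OF i(1)]
  proof eventually_elim
    case (elim x)
    then show ?case using normal_argmax[OF i, of x] z by (simp add: slab_def)
  qed
  then have "slab 1 z \<in> null_sets (M i)"
    using slab_in_sets[OF i(1)] by (simp add: AE_iff_null_sets)
  then have "measure (M i) (slab 1 z) = 0"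
    by (simp add: measure_def null_setsD1)
  then show ?thesis
    using mass[OF i(1)] \<alpha>[OF i(1)] by (simp add: excess_def)
qed

text \<open>For \<open>r < 1\<close>, the excess and the linear part agree in sign at the lowest
  position if \<open>z 0 \<ge> 0\<close> and at the highest otherwise, the excess strictly. For
  \<open>r = 1\<close> the linear part is injective.\<close>

lemma halfspace_line_homotopy_nonzero:
  assumes z: "z \<in> topspace (nsphere d)" and r: "0 \<le> r" "r \<le> 1"
  shows "\<exists>i\<le>d. (1 - r) * excess 1 z i + r * (z 0 - pos z i) \<noteq> 0"
proof (cases "r = 1")
  case True
  have "\<exists>i\<le>d. z i \<noteq> 0"
  proof (rule ccontr)
    assume "\<not> ?thesis"
    then have "(\<Sum>i\<le>d. (z i)\<^sup>2) = 0" by simp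
    then show False using z by (simp add: nsphere)
  qed
  then obtain i where i: "i \<le> d" "z i \<noteq> 0" by blast
  \<comment> \<open>Component 0 equals \<open>z 0\<close>; if that vanishes, component
    \<open>i\<close> equals \<open>- z i\<close>.\<close>
  have "z 0 - pos z (if z 0 = 0 then i else 0) \<noteq> 0"
    using i(2) by (cases "i = 0") (auto simp: pos_def)
  then have "\<exists>i\<le>d. z 0 - pos z i \<noteq> 0"
    using i(1) by (metis le0)
  then show ?thesis using True by simp
next
  case False
  then have r: "0 \<le> r" "r < 1" using r by auto
  show ?thesis
  proof (cases "z 0 \<ge> 0")
    case True
    obtain i where i: "i \<le> d" "\<And>j. j \<le> d \<Longrightarrow> pos z i \<le> pos z j" using ex_argmin by blast
    have "(1 - r) * excess 1 z i > 0" "r * (z 0 - pos z i) \<ge> 0"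
      using excess_halfspace_argmin[OF i True] i(2)[of 0] True r by auto
    then show ?thesis using i(1) by (intro exI[of _ i]) auto
  next
    case False
    obtain i where i: "i \<le> d" "\<And>j. j \<le> d \<Longrightarrow> pos z j \<le> pos z i" using ex_argmax by blast
    have "(1 - r) * excess 1 z i < 0" "r * (z 0 - pos z i) \<le> 0"
      using excess_halfspace_argmax[OF i] i(2)[of 0] False r
      by (auto intro: mult_pos_neg mult_nonneg_nonpos)
    then show ?thesis using i(1) by (intro exI[of _ i]) auto
  qed
qed

lemma ex_zero_excess: "\<exists>t\<in>{0..<1}. \<exists>z\<in>topspace (nsphere d). \<forall>i\<le>d. excess t z i = 0"
proof -
  \<comment> \<open>This linear change of target coordinates turns the components
    \<open>z 0 - pos z i\<close> into \<open>z i\<close>, so the segment ends at the identity; it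
    keeps common zeros and invariance.\<close>
  define F where "F = (\<lambda>t z i. if i = 0 then excess t z 0 else excess t z 0 - excess t z i)"
  have top: "prod_topology (top_of_set {0..1}) (nsphere d) = top_of_set ({0..1::real} \<times> topspace (nsphere d))"
  proof -
    have "nsphere d = top_of_set (topspace (nsphere d))"
      by (simp add: nsphere euclidean_product_topology)
    then show ?thesis
      by (metis euclidean_product_topology prod_topology_subtopology_eu)
  qed
  have "\<exists>t\<in>{0..<1}. \<exists>z\<in>topspace (nsphere d). \<forall>i\<le>d. F t z i = 0"
  proof (rule axis_flip_invariant_homotopy_has_zero[OF d])
    show "continuous_map (prod_topology (top_of_set {0..1}) (nsphere d)) euclideanreal (\<lambda>p. F (fst p) (snd p) i)"
      if "i \<le> d" for i
      unfolding top continuous_map_iff_continuous F_def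
      using that by (cases "i = 0") (auto intro!: continuous_intros continuous_on_excess)
    show "F 0 (axis_flip z) i = F 0 z i" if "z \<in> topspace (nsphere d)" "i \<le> d" for z i
      using that by (simp add: F_def excess_flip)
    show "\<exists>i\<le>d. (1 - r) * F 1 z i + r * z i \<noteq> 0" if r: "r \<in> {0..1}" and z: "z \<in> topspace (nsphere d)" for r z
    proof (rule ccontr)
      assume "\<not> ?thesis"
      then have 0: "(1 - r) * F 1 z i + r * z i = 0" if "i \<le> d" for i using that by blast
      have "(1 - r) * excess 1 z i + r * (z 0 - pos z i) = 0" if "i \<le> d" for i
        using 0[of 0] 0[OF that] by (cases "i = 0") (auto simp: F_def pos_def algebra_simps)
      then show False
        using halfspace_line_homotopy_nonzero[OF z, of r] r by auto
    qed
  qed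
  then obtain t z where tz: "t \<in> {0..<1}" "z \<in> topspace (nsphere d)" "\<And>i. i \<le> d \<Longrightarrow> F t z i = 0" by blast
  have "excess t z i = 0" if "i \<le> d" for i
    using tz(3)[of 0] tz(3)[OF that] by (cases "i = 0") (auto simp: F_def)
  then show ?thesis using tz by blast
qed

lemma ex_common_slab:
  "\<exists>u a b. u \<noteq> 0 \<and> a < b \<and> (\<forall>i\<le>d. measure (M i) {x. a \<le> u \<bullet> x \<and> u \<bullet> x \<le> b} = \<alpha> i * measure (M i) UNIV)"
proof -
  obtain t z where "t \<in> {0..<1}" and "\<forall>i\<le>d. excess t z i = 0"
    using ex_zero_excess by blast
  then have t: "0 \<le> t" "t < 1" and ex: "\<And>i. i \<le> d \<Longrightarrow> excess t z i = 0" by auto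
  then have eq: "measure (M i) (slab t z) = \<alpha> i * measure (M i) UNIV" if "i \<le> d" for i
    using that by (simp add: excess_def)
  define b where "b = offset z + z 0"
  \<comment> \<open>As \<open>t < 1\<close>, the lower constraint may be divided by
    \<open>1 - t\<close>.\<close>
  define a where "a = offset z - \<bar>z 0\<bar> - t / (1 - t)"
  have slab: "slab t z = {x. a \<le> normal z \<bullet> x \<and> normal z \<bullet> x \<le> b}"
  proof -
    have "(1 - t) * a = (1 - t) * (offset z - \<bar>z 0\<bar>) - t"
      using t by (simp add: a_def field_simps)
    moreover have "(1 - t) * a \<le> (1 - t) * (normal z \<bullet> x) \<longleftrightarrow> a \<le> normal z \<bullet> x" for x
      using t by (intro mult_le_cancel_left_pos) simp
    ultimately show ?thesis
      by (auto simp: slab_def b_def)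
  qed
  \<comment> \<open>As \<alpha> lies strictly between 0 and 1, the slab is neither null nor of full
    mass, which excludes a zero normal and \<open>b \<le> a\<close>.\<close>
  have ne: "measure (M 0) (slab t z) \<noteq> 0" "measure (M 0) (slab t z) \<noteq> measure (M 0) UNIV"
    using eq[of 0] \<alpha>[of 0] mass[of 0] by auto
  have "normal z \<noteq> 0"
  proof
    assume "normal z = 0"
    then have "slab t z = {} \<or> slab t z = UNIV" by (auto simp: slab)
    then show False using ne by auto
  qed
  moreover have "a < b"
  proof (rule ccontr)
    assume "\<not> a < b"
    then have "slab t z \<subseteq> {x. normal z \<bullet> x = b}" by (auto simp: slab)
    then have "slab t z \<in> null_sets (M 0)"
      using null_sets_hyperplane[OF ac[of 0], of "normal z" b] \<open>normal z \<noteq> 0\<close> slab_in_sets[of 0]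
      by (auto intro: null_sets_subset)
    then show False using ne by (simp add: measure_def null_setsD1)
  qed
  ultimately show ?thesis
    using eq unfolding slab by blast
qed

end

section \<open>Reduction to the measures of positive mass\<close>

lemma ex_slab_well_separated:
  fixes M :: "'i \<Rightarrow> 'a::euclidean_space measure"
  assumes S: "finite S" and fin: "\<And>i. i \<in> S \<Longrightarrow> finite_measure (M i)"
    and sets: "\<And>i. i \<in> S \<Longrightarrow> sets (M i) = sets borel"
    and ac: "\<And>i. i \<in> S \<Longrightarrow> absolutely_continuous lborel (M i)"
    and sep: "well_separated S (\<lambda>i. measure_support (M i))"
    and \<alpha>: "\<And>i. i \<in> S \<Longrightarrow> 0 < \<alpha> i \<and> \<alpha> i < 1"
  shows "\<exists>u a b. u \<noteq> 0 \<and> a < b \<and>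
           (\<forall>i\<in>S. measure (M i) {x. a \<le> u \<bullet> x \<and> u \<bullet> x \<le> b} = \<alpha> i * measure (M i) UNIV)"
proof -
  define N where "N = {i \<in> S. measure (M i) UNIV > 0}"
  have "finite N" "N \<subseteq> S" using S by (auto simp: N_def)
  \<comment> \<open>For a measure of mass 0 both sides vanish, whatever slab is chosen.\<close>
  have null: "measure (M i) A = \<alpha> i * measure (M i) UNIV" if "i \<in> S - N" for i A
  proof -
    interpret finite_measure "M i" using fin that by auto
    have "measure (M i) UNIV = 0"
      using that measure_nonneg[of "M i" UNIV] by (auto simp: N_def less_le)
    moreover have "measure (M i) A \<le> measure (M i) (space (M i))"
      by (rule bounded_measure)
    moreover have "space (M i) = UNIV"
      using sets_eq_imp_space_eq[OF sets, of i] that by simp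
    ultimately show ?thesis
      using measure_nonneg[of "M i" A] by simp
  qed
  have "\<exists>u a b. u \<noteq> 0 \<and> a < b \<and>
      (\<forall>i\<in>N. measure (M i) {x. a \<le> u \<bullet> x \<and> u \<bullet> x \<le> b} = \<alpha> i * measure (M i) UNIV)"
  proof (cases "card N \<le> 1")
    case True
    then consider "N = {}" | i where "N = {i}"
      using \<open>finite N\<close> by (metis card_0_eq card_1_singletonE le_neq_implies_less less_one)
    then show ?thesis
    proof cases
      case 1
      obtain e :: 'a where "e \<noteq> 0"
        using nonempty_Basis nonzero_Basis by blast
      then show ?thesis using 1 by (intro exI[of _ e] exI[of _ 0] exI[of _ 1]) auto
    next
      case (2 i)
      then have i: "i \<in> S" "measure (M i) UNIV > 0" by (auto simp: N_def)
      show ?thesis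
        using ex_slab_single_measure[OF fin sets ac _ _ i(2), of "\<alpha> i"] i(1) \<alpha>[OF i(1)] 2 by auto
    qed
  next
    case False
    define d where "d = card N - 1"
    have d: "d > 0" "{0..<card N} = {..d}"
      using False by (auto simp: d_def)
    obtain h where h: "bij_betw h {..d} N"
      using ex_bij_betw_nat_finite[OF \<open>finite N\<close>] d(2) by metis
    then have hN: "h i \<in> N" if "i \<le> d" for i
      using that by (auto simp: bij_betw_def)
    then have hS: "h i \<in> S" if "i \<le> d" for i
      using that \<open>N \<subseteq> S\<close> by auto
    let ?K = "\<lambda>i. measure_support (M (h i))"
    have "\<exists>u c. u \<noteq> 0 \<and> (\<forall>i\<in>I. \<forall>x\<in>?K i. u \<bullet> x \<le> c) \<and> (\<forall>i\<in>{..d} - I. \<forall>x\<in>?K i. c \<le> u \<bullet> x)"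
      if I: "I \<subset> {..d}" "I \<noteq> {}" for I
    proof -
      \<comment> \<open>The separation hypothesis concerns partitions of all of \<open>S\<close>, so
        the indices of mass 0 are put on the side of the complement.\<close>
      have J: "h ` ({..d} - I) \<subseteq> S - h ` I"
        using h I(1) hS by (auto simp: bij_betw_def inj_on_def)
      have *: "h ` I \<union> (S - h ` I) = S" "h ` I \<inter> (S - h ` I) = {}" "h ` I \<noteq> {}" "S - h ` I \<noteq> {}"
        using I hS J by blast+
      obtain u c where "u \<noteq> 0" "(\<Union>i\<in>h ` I. measure_support (M i)) \<subseteq> {x. u \<bullet> x \<le> c}"
          "(\<Union>i\<in>S - h ` I. measure_support (M i)) \<subseteq> {x. u \<bullet> x \<ge> c}"
        using sep * unfolding well_separated_def by metis
      then show ?thesis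
        using J by (intro exI[of _ u] exI[of _ c] conjI) blast+
    qed
    then obtain U C where UC: "\<And>I. \<lbrakk>I \<subset> {..d}; I \<noteq> {}\<rbrakk> \<Longrightarrow> U I \<noteq> 0 \<and>
        (\<forall>i\<in>I. \<forall>x\<in>?K i. U I \<bullet> x \<le> C I) \<and> (\<forall>i\<in>{..d} - I. \<forall>x\<in>?K i. C I \<le> U I \<bullet> x)"
      by metis
    interpret separated_measures d "\<lambda>i. M (h i)" ?K U C "\<lambda>i. \<alpha> (h i)"
    proof (rule separated_measures.intro)
      show "measure (M (h i)) UNIV > 0" if "i \<le> d" for i
        using hN[OF that] by (simp add: N_def)
      show "AE x in M (h i). x \<in> ?K i" if "i \<le> d" for i
        using sets hS[OF that] by (intro AE_measure_support) auto
      show "d > 0" by (rule d(1))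
      show "finite_measure (M (h i))" "sets (M (h i)) = sets borel"
          "absolutely_continuous lborel (M (h i))" if "i \<le> d" for i
        using fin sets ac hS[OF that] by simp_all
      show "0 < \<alpha> (h i) \<and> \<alpha> (h i) < 1" if "i \<le> d" for i
        using \<alpha> hS[OF that] by simp
      show "U I \<noteq> 0" if "I \<subset> {..d}" "I \<noteq> {}" for I
        using UC[OF that] by blast
      show "U I \<bullet> x \<le> C I" if "I \<subset> {..d}" "I \<noteq> {}" "i \<in> I" "x \<in> ?K i" for I i x
        using UC[OF that(1,2)] that(3,4) by blast
      show "C I \<le> U I \<bullet> x" if "I \<subset> {..d}" "I \<noteq> {}" "i \<in> {..d} - I" "x \<in> ?K i" for I i x
        using UC[OF that(1,2)] that(3,4) by blast
    qed
    obtain u a b where "u \<noteq> 0" "a < b" and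
      eq: "\<And>i. i \<le> d \<Longrightarrow> measure (M (h i)) {x. a \<le> u \<bullet> x \<and> u \<bullet> x \<le> b} = \<alpha> (h i) * measure (M (h i)) UNIV"
      using ex_common_slab by blast
    moreover have "\<forall>j\<in>N. measure (M j) {x. a \<le> u \<bullet> x \<and> u \<bullet> x \<le> b} = \<alpha> j * measure (M j) UNIV"
      using eq h by (auto simp: bij_betw_def)
    ultimately show ?thesis by blast
  qed
  then show ?thesis
    using null by blast
qed

theorem theorem1p5:
  fixes \<mu> :: "nat \<Rightarrow> (real ^ 'n) measure"
    and \<alpha> :: "nat \<Rightarrow> real"
  assumes "\<And>i. i \<in> {1..CARD('n) + 1} \<Longrightarrow> finite_measure (\<mu> i)"
    and "\<And>i. i \<in> {1..CARD('n) + 1} \<Longrightarrow> sets (\<mu> i) = sets borel"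
    and "\<And>i. i \<in> {1..CARD('n) + 1} \<Longrightarrow> absolutely_continuous lborel (\<mu> i)"
    and "well_separated {1..CARD('n) + 1} (\<lambda>i. measure_support (\<mu> i))"
    and "\<And>i. i \<in> {1..CARD('n) + 1} \<Longrightarrow> 0 < \<alpha> i \<and> \<alpha> i < 1"
  shows "\<exists>(u :: real ^ 'n) a b. u \<noteq> 0 \<and> a < b \<and>
           (\<forall>i\<in>{1..CARD('n) + 1}.
              measure (\<mu> i) {x. a \<le> u \<bullet> x \<and> u \<bullet> x \<le> b} = \<alpha> i * measure (\<mu> i) UNIV)"
  by (rule ex_slab_well_separated) (use assms in auto)

end
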